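(* Let $f^*(u,v,w)=-\sum_{i\in[d]}\ln\big(w_i-u\ln(u/v_i)+u\big)-d\ln(u)-\sum_{i\in[d]}\ln(v_i)$ and let $z=(u,v,w)$ be in the interior of $\mathcal{K}^*_{\mathrm{rel}}$. Then the Hessian $H^*(z)=\nabla^2f^*(z)$ is augmented-sparse with $n_1=n_2=0$: it satisfies $H^*(z)\succ0$, is sparse for $d\gg1$, and has the form $$H^*(z)=\begin{bmatrix}\nabla^2_{u,u}f^*&\nabla^2_{u,v}f^*&\nabla^2_{u,w}f^*\\ \nabla^2_{v,u}f^*&D_{v,v}&D_{v,w}\\ \nabla^2_{w,u}f^*&D_{w,v}&D_{w,w}\end{bmatrix},$$ where, with $\gamma_i=w_i-u\ln(u/v_i)+u>0$ for $i\in[d]$, the lower right $2\times2$ blocks are the $d\times d$ diagonal matrices $$D_{v,v}=\mathrm{Diag}\Big(\Big[\frac{u(\gamma_i+u)}{\gamma_i^2v_i^2}+\frac1{v_i^2}\Big]_{i\in[d]}\Big),\quad D_{w,w}=\mathrm{Diag}\Big(\Big[\frac1{\gamma_i^2}\Big]_{i\in[d]}\Big),\quad D_{v,w}=D_{w,v}=\mathrm{Diag}\Big(\Big[\frac{u}{\gamma_i^2v_i}\Big]_{i\in[d]}\Big).$$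
   Context: $[d]=\{1,\dots,d\}$; $\mathbb{R}^d_{++}$ is the set of vectors with positive entries. $\mathcal{K}^*_{\mathrm{rel}}=\mathrm{cl}\{(u,v,w)\in\mathbb{R}_{++}\times\mathbb{R}^d_{++}\times\mathbb{R}^d:w_i\ge u(\ln(u/v_i)-1)\ \forall i\in[d]\}$ is the dual of the relative entropy cone; its interior is the set where $u>0$, $v\in\mathbb{R}^d_{++}$ and all $\gamma_i>0$. Here $u\in\mathbb{R}$ is a scalar, so the first block row and column have width one. A symmetric matrix $H$ is called augmented-sparse (with parameters $n_1,n_2$) if $H=D+\sum_{i=1}^{n_1}u_iu_i^\top-\sum_{j=1}^{n_2}v_jv_j^\top$ with $D$ symmetric and sparse, $n_1,n_2$ small compared with the dimension, and $D-\sum_jv_jv_j^\top\succ0$; with $n_1=n_2=0$ this means $H=D$ is itself sparse and positive definite. "Sparse for $d\gg1$" is qualitative and refers to the displayed structure: apart from the first row and column, all blocks are diagonal. *)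

theory Defs
  imports "HOL-Analysis.Analysis"
begin

section \<open>Derivatives of real functions of several variables\<close>

definition partial_deriv :: "'n \<Rightarrow> (real^'n \<Rightarrow> real) \<Rightarrow> real^'n \<Rightarrow> real" where
  "partial_deriv i f x = deriv (\<lambda>t. f (x + t *\<^sub>R axis i 1)) 0"

definition gradient :: "(real^'n \<Rightarrow> real) \<Rightarrow> real^'n \<Rightarrow> real^'n" where
  "gradient f x = (\<chi> i. partial_deriv i f x)"

definition hessian :: "(real^'n \<Rightarrow> real) \<Rightarrow> real^'n \<Rightarrow> real^'n^'n" where
  "hessian f x = (\<chi> i j. partial_deriv j (partial_deriv i f) x)"

text \<open>\<^const>\<open>deriv\<close> is an unspecified value where the derivative does not exist; the following
  guarantees that all entries of the Hessian are genuine second derivatives.\<close>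

definition twice_differentiable_at :: "(real^'n::finite \<Rightarrow> real) \<Rightarrow> real^'n \<Rightarrow> bool" where
  "twice_differentiable_at f x \<longleftrightarrow>
     (\<forall>\<^sub>F y in nhds x. f differentiable (at y)) \<and> gradient f differentiable (at x)"

text \<open>The block of second partial derivatives whose rows and columns are the coordinates
  selected by \<open>r\<close> and \<open>c\<close>.\<close>

definition hessian_block ::
    "('a \<Rightarrow> 'n) \<Rightarrow> ('b \<Rightarrow> 'n) \<Rightarrow> (real^'n \<Rightarrow> real) \<Rightarrow> real^'n \<Rightarrow> real^'b^'a" where
  "hessian_block r c f x = (\<chi> i j. partial_deriv (c j) (partial_deriv (r i) f) x)"


section \<open>Matrices\<close>

definition pos_def :: "real^'n^'n::finite \<Rightarrow> bool" where
  "pos_def A \<longleftrightarrow> transpose A = A \<and> (\<forall>x. x \<noteq> 0 \<longrightarrow> x \<bullet> (A *v x) > 0)"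

definition outer :: "real^'n \<Rightarrow> real^'n^'n" where
  "outer x = (\<chi> i j. x$i * x$j)"

text \<open>``Sparse'' is a qualitative notion, so the sparsity requirement is a parameter.\<close>

definition augmented_sparse ::
    "(real^'n^'n \<Rightarrow> bool) \<Rightarrow> nat \<Rightarrow> nat \<Rightarrow> real^'n^'n::finite \<Rightarrow> bool" where
  "augmented_sparse is_sparse n1 n2 H \<longleftrightarrow>
     (\<exists>D U V. transpose D = D \<and> is_sparse D \<and>
        H = D + (\<Sum>i<n1. outer (U i)) - (\<Sum>j<n2. outer (V j)) \<and>
        pos_def (D - (\<Sum>j<n2. outer (V j))))"

definition Diag :: "real^'d \<Rightarrow> real^'d^'d" where
  "Diag x = (\<chi> i j. if i = j then x$i else 0)"


section \<open>Stacked coordinates\<close>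

text \<open>The vector \<open>(u, v, w)\<close> of dimension \<open>1 + d + d\<close> is indexed by \<open>unit + 'd + 'd\<close>.\<close>

abbreviation ix_u :: "unit \<Rightarrow> unit + 'd + 'd" where "ix_u \<equiv> Inl"
abbreviation ix_v :: "'d \<Rightarrow> unit + 'd + 'd" where "ix_v \<equiv> \<lambda>i. Inr (Inl i)"
abbreviation ix_w :: "'d \<Rightarrow> unit + 'd + 'd" where "ix_w \<equiv> \<lambda>i. Inr (Inr i)"

definition stack :: "real \<times> (real^'d) \<times> (real^'d) \<Rightarrow> real^(unit + 'd + 'd)" where
  "stack = (\<lambda>(u, v, w). \<chi> k. case k of Inl _ \<Rightarrow> u | Inr (Inl i) \<Rightarrow> v$i | Inr (Inr i) \<Rightarrow> w$i)"

definition unstack :: "real^(unit + 'd + 'd) \<Rightarrow> real \<times> (real^'d) \<times> (real^'d)" where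
  "unstack x = (x $ ix_u (), \<chi> i. x $ ix_v i, \<chi> i. x $ ix_w i)"

definition block_matrix ::
    "real^'a^'a \<Rightarrow> real^'b^'a \<Rightarrow> real^'c^'a \<Rightarrow>
     real^'a^'b \<Rightarrow> real^'b^'b \<Rightarrow> real^'c^'b \<Rightarrow>
     real^'a^'c \<Rightarrow> real^'b^'c \<Rightarrow> real^'c^'c \<Rightarrow> real^('a + 'b + 'c)^('a + 'b + 'c)" where
  "block_matrix Aaa Aab Aac Aba Abb Abc Aca Acb Acc = (\<chi> p q.
     case p of
       Inl i \<Rightarrow> (case q of Inl j \<Rightarrow> Aaa$i$j | Inr (Inl j) \<Rightarrow> Aab$i$j | Inr (Inr j) \<Rightarrow> Aac$i$j)
     | Inr (Inl i) \<Rightarrow> (case q of Inl j \<Rightarrow> Aba$i$j | Inr (Inl j) \<Rightarrow> Abb$i$j | Inr (Inr j) \<Rightarrow> Abc$i$j)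
     | Inr (Inr i) \<Rightarrow> (case q of Inl j \<Rightarrow> Aca$i$j | Inr (Inl j) \<Rightarrow> Acb$i$j | Inr (Inr j) \<Rightarrow> Acc$i$j))"

text \<open>Apart from the first row and column, all blocks are diagonal. Such a matrix has at most
  \<open>8 * d + 1\<close> nonzero entries, out of \<open>(2 * d + 1)^2\<close>.\<close>

definition block_sparse :: "real^(unit + 'd + 'd)^(unit + 'd::finite + 'd) \<Rightarrow> bool" where
  "block_sparse M \<longleftrightarrow> (\<forall>i j. i \<noteq> j \<longrightarrow>
     M $ ix_v i $ ix_v j = 0 \<and> M $ ix_v i $ ix_w j = 0 \<and>
     M $ ix_w i $ ix_v j = 0 \<and> M $ ix_w i $ ix_w j = 0)"


section \<open>The dual of the relative entropy cone and its barrier\<close>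

definition Krel_dual :: "(real \<times> (real^'d) \<times> (real^'d)) set" where
  "Krel_dual = closure {(u, v, w). u > 0 \<and> (\<forall>i. v$i > 0) \<and>
     (\<forall>i. w$i \<ge> u * (ln (u / v$i) - 1))}"

definition fstar :: "real \<times> (real^'d) \<times> (real^'d) \<Rightarrow> real" where
  "fstar = (\<lambda>(u, v, w). - (\<Sum>i\<in>UNIV. ln (w$i - u * ln (u / v$i) + u))
     - real CARD('d) * ln u - (\<Sum>i\<in>UNIV. ln (v$i)))"

definition gam :: "real \<Rightarrow> real^'d \<Rightarrow> real^'d \<Rightarrow> 'd \<Rightarrow> real" where
  "gam u v w i = w$i - u * ln (u / v$i) + u"

end

theory Submission
  imports Defs
begin

text \<open>
  On the region where \<open>u\<close>, all \<open>v\<^sub>i\<close> and all slacks \<open>\<gamma>\<^sub>i\<close> are positive, the barrier is a sum of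
  functions of the form \<open>- ln\<close>. The slack \<open>\<gamma>\<^sub>i\<close> depends on \<open>u\<close>, \<open>v\<^sub>i\<close> and \<open>w\<^sub>i\<close> only, so no second
  derivative couples two different indices except through \<open>u\<close>; this is the sparsity. Each term
  \<open>- ln \<gamma>\<^sub>i\<close> has Hessian \<open>\<nabla>\<gamma>\<^sub>i \<nabla>\<gamma>\<^sub>i\<^sup>T / \<gamma>\<^sub>i\<^sup>2 - \<nabla>\<^sup>2\<gamma>\<^sub>i / \<gamma>\<^sub>i\<close>, and \<open>\<gamma>\<^sub>i\<close> is concave because relative
  entropy is jointly convex. Evaluating the quadratic form at \<open>h\<close> therefore yields a sum of squares
  (\<open>hessian_quadratic_form\<close>). If it vanishes, the terms from \<open>- ln u\<close> and \<open>- ln v\<^sub>i\<close> force the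
  \<open>u\<close>- and \<open>v\<close>-coordinates of \<open>h\<close> to be zero, and then the terms \<open>(\<nabla>\<gamma>\<^sub>i \<bullet> h)\<^sup>2 / \<gamma>\<^sub>i\<^sup>2\<close> force the
  \<open>w\<close>-coordinates to be zero, since \<open>\<partial>\<gamma>\<^sub>i/\<partial>w\<^sub>i = 1\<close>.

  Three points need care. The cone is a closure, so that positivity in its interior requires an
  argument (\<open>interior_Krel_dual_positive\<close>): weak inequalities survive in the closure, and moving
  slightly in a decreasing direction turns them into strict ones. Partial derivatives are taken of
  total functions, so the gradient formula must hold in a neighbourhood
  (\<open>eventually_in_barrier_region\<close>) before it may be differentiated again. Finally, the Hessian is
  obtained from Frechet derivatives (\<open>fstar_has_derivative\<close> and
  \<open>barrier_gradient_has_derivative\<close>), which also give twice differentiability.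
\<close>

section \<open>Partial derivatives from Frechet derivatives\<close>

lemma partial_deriv_eq:
  assumes "(f has_derivative D) (at x)"
  shows "partial_deriv i f x = D (axis i 1)"
proof -
  have "((\<lambda>t. x + t *\<^sub>R axis i 1) has_derivative (\<lambda>t. t *\<^sub>R axis i 1)) (at (0::real))"
    by (auto intro!: derivative_eq_intros)
  then have "((\<lambda>t. f (x + t *\<^sub>R axis i 1)) has_derivative (\<lambda>t. D (t *\<^sub>R axis i 1))) (at (0::real))"
    using assms by (auto intro: has_derivative_compose[where g = f])
  moreover have "D (t *\<^sub>R axis i 1) = D (axis i 1) * t" for t
    using assms by (simp add: has_derivative_def linear_simps bounded_linear.linear linear_cmul)
  ultimately have "((\<lambda>t. f (x + t *\<^sub>R axis i 1)) has_field_derivative D (axis i 1)) (at 0)"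
    by (simp add: has_field_derivative_def)
  then show ?thesis
    unfolding partial_deriv_def by (rule DERIV_imp_deriv)
qed

lemma partial_deriv_cong:
  assumes "\<forall>\<^sub>F y in nhds x. f y = g y"
  shows "partial_deriv i f x = partial_deriv i g x"
proof -
  have "((\<lambda>t::real. x + t *\<^sub>R axis i 1) \<longlongrightarrow> x + 0 *\<^sub>R axis i 1) (nhds 0)"
    by (intro tendsto_intros filterlim_ident)
  then have "filterlim (\<lambda>t::real. x + t *\<^sub>R axis i 1) (nhds x) (nhds 0)"
    by simp
  with assms have "\<forall>\<^sub>F t in nhds 0. f (x + t *\<^sub>R axis i 1) = g (x + t *\<^sub>R axis i 1)"
    by (rule eventually_compose_filterlim)
  then show ?thesis
    unfolding partial_deriv_def by (intro deriv_cong_ev) auto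
qed

text \<open>The pointwise formula for the gradient is needed in a whole neighbourhood: only then can it
  replace the family of first partial derivatives under a further differentiation.\<close>

lemma hessian_from_gradient:
  fixes f :: "real^'n::finite \<Rightarrow> real"
  assumes grad: "\<forall>\<^sub>F y in nhds x. (f has_derivative (\<lambda>h. G y \<bullet> h)) (at y)"
    and G: "(G has_derivative (\<lambda>h. M *v h)) (at x)"
  shows "twice_differentiable_at f x"
    and "partial_deriv j (partial_deriv i f) x = M $ i $ j"
proof -
  have pd: "\<forall>\<^sub>F y in nhds x. partial_deriv i f y = G y $ i" for i
    using grad by eventually_elim (simp add: partial_deriv_eq inner_axis)
  have eq: "\<forall>\<^sub>F y in nhds x. G y = gradient f y"
    using grad by eventually_elim (simp add: gradient_def vec_eq_iff partial_deriv_eq inner_axis)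
  have "(gradient f has_derivative (\<lambda>h. M *v h)) (at x)"
    by (rule has_derivative_transform_eventually[OF G])
      (use eq eventually_nhds_x_imp_x[OF eq] in
        \<open>auto simp: eventually_at_filter elim: eventually_mono\<close>)
  then show "twice_differentiable_at f x"
    unfolding twice_differentiable_at_def
    using grad by (auto simp: differentiable_def elim: eventually_mono)
  have "((\<lambda>y. G y $ i) has_derivative (\<lambda>h. (M *v h) $ i)) (at x)"
    using G by (rule bounded_linear.has_derivative[OF bounded_linear_vec_nth])
  then have "partial_deriv j (\<lambda>y. G y $ i) x = M $ i $ j"
    by (simp add: partial_deriv_eq matrix_vector_mul_component inner_axis)
  then show "partial_deriv j (partial_deriv i f) x = M $ i $ j"
    using partial_deriv_cong[OF pd] by simp
qed

section \<open>Positivity in the interior of the dual cone\<close>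

text \<open>The slack inequality is only claimed for \<open>u > 0\<close> and \<open>v\<^sub>i > 0\<close>, where the slack is continuous
  and the inequality passes to limits.\<close>

lemma Krel_dual_nonneg:
  fixes v w :: "real^'d"
  assumes "(u, v, w) \<in> Krel_dual"
  shows "u \<ge> 0" and "v $ i \<ge> 0" and "u > 0 \<Longrightarrow> v $ i > 0 \<Longrightarrow> gam u v w i \<ge> 0"
proof -
  define S :: "(real \<times> (real^'d) \<times> (real^'d)) set" where
    "S = {(u, v, w). u > 0 \<and> (\<forall>i. v$i > 0) \<and> (\<forall>i. w$i \<ge> u * (ln (u / v$i) - 1))}"
  obtain X where X: "\<And>n. X n \<in> S" and lim: "X \<longlonglongrightarrow> (u, v, w)"
    using assms unfolding Krel_dual_def S_def[symmetric] closure_sequential by blast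
  define U V W where "U n = fst (X n)" and "V n = fst (snd (X n))" and "W n = snd (snd (X n))" for n
  have U: "U \<longlonglongrightarrow> u" and V: "(\<lambda>n. V n $ i) \<longlonglongrightarrow> v $ i" and W: "(\<lambda>n. W n $ i) \<longlonglongrightarrow> w $ i" for i
    unfolding U_def V_def W_def
    using tendsto_fst[OF lim] tendsto_fst[OF tendsto_snd[OF lim]] tendsto_snd[OF tendsto_snd[OF lim]]
    by (auto intro: tendsto_vec_nth)
  have pos: "U n > 0" "V n $ i > 0" "gam (U n) (V n) (W n) i \<ge> 0" for n i
    using X[of n] by (auto simp: S_def U_def V_def W_def gam_def algebra_simps split_beta)
  show "u \<ge> 0"
    by (rule LIMSEQ_le_const[OF U]) (use pos less_imp_le in blast)
  show "v $ i \<ge> 0"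
    by (rule LIMSEQ_le_const[OF V]) (use pos less_imp_le in blast)
  assume "u > 0" "v $ i > 0"
  then have "(\<lambda>n. gam (U n) (V n) (W n) i) \<longlonglongrightarrow> gam u v w i"
    unfolding gam_def by (intro tendsto_intros U V W) auto
  then show "gam u v w i \<ge> 0"
    by (rule LIMSEQ_le_const) (use pos in blast)
qed

lemma interior_Krel_dual_positive:
  fixes v w :: "real^'d"
  assumes "(u, v, w) \<in> interior Krel_dual"
  shows "u > 0" and "v $ i > 0" and "gam u v w i > 0"
proof -
  have move: "\<exists>t>0. (u, v, w) + t *\<^sub>R e \<in> Krel_dual" for e
  proof -
    have "((\<lambda>t. (u, v, w) + t *\<^sub>R e) \<longlongrightarrow> (u, v, w) + 0 *\<^sub>R e) (at_right 0)"
      by (intro tendsto_intros)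
    then have "\<forall>\<^sub>F t in at_right 0. (u, v, w) + t *\<^sub>R e \<in> interior Krel_dual"
      using assms by (intro topological_tendstoD) auto
    then have "\<forall>\<^sub>F t::real in at_right 0. t > 0 \<and> (u, v, w) + t *\<^sub>R e \<in> interior Krel_dual"
      by (intro eventually_conj eventually_at_right_less)
    then obtain t where "t > 0" "(u, v, w) + t *\<^sub>R e \<in> interior Krel_dual"
      using eventually_happens'[OF trivial_limit_at_right_real] by blast
    then show ?thesis
      using interior_subset by blast
  qed
  \<comment> \<open>The sign of \<open>u\<close> and \<open>v\<close> comes first: the bound on the slack of the third shifted point
    presupposes it.\<close>
  obtain t where "t > 0" "(u - t, v, w) \<in> Krel_dual"
    using move[of "(-1, 0, 0)"] by auto
  then show u: "u > 0"
    using Krel_dual_nonneg(1) by force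
  obtain t where "t > 0" "(u, v - t *\<^sub>R 1, w) \<in> Krel_dual"
    using move[of "(0, -1, 0)"] by auto
  then show v: "v $ i > 0"
    using Krel_dual_nonneg(2)[of u "v - t *\<^sub>R 1" w i] by simp
  obtain t where "t > 0" "(u, v, w - t *\<^sub>R 1) \<in> Krel_dual"
    using move[of "(0, 0, -1)"] by auto
  then show "gam u v w i > 0"
    using Krel_dual_nonneg(3)[of u v "w - t *\<^sub>R 1" i] u v by (simp add: gam_def)
qed

section \<open>First and second derivatives of the barrier\<close>

definition slack :: "'d \<Rightarrow> real^(unit + 'd::finite + 'd) \<Rightarrow> real" where
  "slack i x = x $ ix_w i - x $ ix_u () * ln (x $ ix_u () / x $ ix_v i) + x $ ix_u ()"

definition barrier_region :: "(real^(unit + 'd::finite + 'd)) set" where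
  "barrier_region = {x. x $ ix_u () > 0 \<and> (\<forall>i. x $ ix_v i > 0 \<and> slack i x > 0)}"

lemma fstar_unstack:
  "(fstar \<circ> unstack) x = - (\<Sum>i\<in>UNIV. ln (slack i x))
     - real CARD('d) * ln (x $ ix_u ()) - (\<Sum>i\<in>UNIV. ln (x $ ix_v i))"
  for x :: "real^(unit + 'd::finite + 'd)"
  by (simp add: fstar_def unstack_def slack_def)

definition slack_deriv ::
    "'d \<Rightarrow> real^(unit + 'd::finite + 'd) \<Rightarrow> real^(unit + 'd + 'd) \<Rightarrow> real" where
  "slack_deriv i x h = h $ ix_w i + x $ ix_u () / x $ ix_v i * h $ ix_v i
     - ln (x $ ix_u () / x $ ix_v i) * h $ ix_u ()"

lemma has_derivative_component [derivative_intros]: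
  "((\<lambda>x::real^'n::finite. x $ k) has_derivative (\<lambda>h. h $ k)) (at x)"
  by (rule bounded_linear_imp_has_derivative) (rule bounded_linear_vec_nth)

lemma log_ratio_has_derivative:
  fixes x :: "real^'n::finite"
  assumes "x $ k > 0" "x $ l > 0"
  shows "((\<lambda>x. ln (x $ k / x $ l)) has_derivative (\<lambda>h. h $ k / x $ k - h $ l / x $ l)) (at x)"
  using assms by (auto intro!: derivative_eq_intros simp: field_simps)

lemma slack_has_derivative:
  assumes "x $ ix_u () > 0" "x $ ix_v i > 0"
  shows "(slack i has_derivative slack_deriv i x) (at x)"
  unfolding slack_def slack_deriv_def[abs_def] using assms
  by (auto intro!: derivative_eq_intros log_ratio_has_derivative simp: field_simps)

text \<open>Openness of the region cannot be read off from continuity on the whole space, since the slack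
  is discontinuous where \<open>v\<^sub>i = 0\<close> and \<open>u \<noteq> 0\<close>; it is continuous at each point of the region.\<close>

lemma eventually_in_barrier_region:
  assumes "x \<in> barrier_region"
  shows "\<forall>\<^sub>F y in nhds x. y \<in> barrier_region"
proof -
  have ev: "\<forall>\<^sub>F y in nhds x. g y > 0" if "isCont g x" "g x > 0" for g :: "_ \<Rightarrow> real"
    using that by (auto intro: order_tendstoD simp: continuous_within tendsto_at_iff_tendsto_nhds)
  have "isCont (slack i) x" for i
    by (rule has_derivative_continuous[OF slack_has_derivative]) (use assms in \<open>auto simp: barrier_region_def\<close>)
  with assms show ?thesis
    unfolding barrier_region_def mem_Collect_eq
    by (intro eventually_conj eventually_all_finite ev continuous_intros) auto
qed

definition barrier_gradient ::
    "real^(unit + 'd::finite + 'd) \<Rightarrow> real^(unit + 'd + 'd)" where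
  "barrier_gradient x = stack
     ((\<Sum>i\<in>UNIV. ln (x $ ix_u () / x $ ix_v i) / slack i x) - real CARD('d) / x $ ix_u (),
      \<chi> i. - x $ ix_u () / (x $ ix_v i * slack i x) - 1 / x $ ix_v i,
      \<chi> i. - 1 / slack i x)"

text \<open>The row and column of \<open>u\<close> are given explicitly because the quadratic form involves them.
  The contribution \<open>d / u\<^sup>2\<close> of \<open>- d ln u\<close> is distributed over the sum in the corner entry, so that
  the quadratic form splits index by index.\<close>

definition barrier_hessian ::
    "real^(unit + 'd::finite + 'd) \<Rightarrow> real^(unit + 'd + 'd)^(unit + 'd + 'd)" where
  "barrier_hessian x = (let u = x $ ix_u (); \<gamma> = (\<lambda>i. slack i x);
       v = (\<lambda>i. x $ ix_v i); l = (\<lambda>i. ln (u / v i));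
       uv = (\<lambda>i. - 1 / (v i * \<gamma> i) - u * l i / (v i * (\<gamma> i)\<^sup>2));
       uw = (\<lambda>i. - l i / (\<gamma> i)\<^sup>2);
       vw = Diag (\<chi> i. u / ((\<gamma> i)\<^sup>2 * v i)) in
     block_matrix
       (\<chi> _ _. \<Sum>i\<in>UNIV. (1 / (u * \<gamma> i) + (l i)\<^sup>2 / (\<gamma> i)\<^sup>2 + 1 / u\<^sup>2)) (\<chi> _ i. uv i) (\<chi> _ i. uw i)
       (\<chi> i _. uv i) (Diag (\<chi> i. u * (\<gamma> i + u) / ((\<gamma> i)\<^sup>2 * (v i)\<^sup>2) + 1 / (v i)\<^sup>2)) vw
       (\<chi> i _. uw i) vw (Diag (\<chi> i. 1 / (\<gamma> i)\<^sup>2)))"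

lemma sum_stacked: "sum g (UNIV :: (unit + 'd::finite + 'd) set) =
    g (ix_u ()) + (\<Sum>i\<in>UNIV. g (ix_v i)) + (\<Sum>i\<in>UNIV. g (ix_w i))"
  by (simp add: UNIV_Plus_UNIV[symmetric] sum.Plus UNIV_unit add.assoc del: UNIV_Plus_UNIV)

lemma sum_Diag: "(\<Sum>j\<in>UNIV. Diag a $ i $ j * y j) = a $ i * y i"
  by (simp add: Diag_def if_distrib[where f = "\<lambda>t. t * _"] cong: if_cong)

lemma fstar_has_derivative:
  fixes x :: "real^(unit + 'd::finite + 'd)"
  assumes x: "x \<in> barrier_region"
  shows "((fstar \<circ> unstack) has_derivative (\<lambda>h. barrier_gradient x \<bullet> h)) (at x)"
proof -
  have [simp]: "x $ ix_u () \<noteq> 0" "x $ ix_v i \<noteq> 0" "slack i x \<noteq> 0" 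
    and pos: "x $ ix_u () > 0" "x $ ix_v i > 0" "slack i x > 0" for i
    using x by (auto simp: barrier_region_def less_imp_neq[THEN not_sym])
  have "((fstar \<circ> unstack) has_derivative
      (\<lambda>h. - (\<Sum>i\<in>UNIV. slack_deriv i x h / slack i x)
        - real CARD('d) * (h $ ix_u () / x $ ix_u ()) - (\<Sum>i\<in>UNIV. h $ ix_v i / x $ ix_v i))) (at x)"
    unfolding fstar_unstack[abs_def] using pos
    by (auto intro!: has_derivative_diff has_derivative_minus has_derivative_sum
        has_derivative_mult_right derivative_eq_intros slack_has_derivative simp: field_simps)
  moreover have "- (\<Sum>i\<in>UNIV. slack_deriv i x h / slack i x)
        - real CARD('d) * (h $ ix_u () / x $ ix_u ()) - (\<Sum>i\<in>UNIV. h $ ix_v i / x $ ix_v i)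
      = barrier_gradient x \<bullet> h" for h
  proof -
    have "- slack_deriv i x h / slack i x - h $ ix_v i / x $ ix_v i =
        ln (x $ ix_u () / x $ ix_v i) / slack i x * h $ ix_u ()
        + (- x $ ix_u () / (x $ ix_v i * slack i x) - 1 / x $ ix_v i) * h $ ix_v i
        + - 1 / slack i x * h $ ix_w i" for i
      by (simp add: slack_deriv_def add_divide_distrib diff_divide_distrib algebra_simps)
    then have "(\<Sum>i\<in>UNIV. - slack_deriv i x h / slack i x - h $ ix_v i / x $ ix_v i) =
        (\<Sum>i\<in>UNIV. ln (x $ ix_u () / x $ ix_v i) / slack i x * h $ ix_u ()
        + (- x $ ix_u () / (x $ ix_v i * slack i x) - 1 / x $ ix_v i) * h $ ix_v i
        + - 1 / slack i x * h $ ix_w i)"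
      by simp
    then show ?thesis
      by (simp add: inner_vec_def sum_stacked barrier_gradient_def stack_def sum.distrib
          sum_subtractf sum_negf sum_distrib_right left_diff_distrib)
  qed
  ultimately show ?thesis
    by simp
qed

text \<open>Grouping each row around the differential of the slack is the form in which both the
  differentiation of the gradient and the quadratic form produce it.\<close>

lemma barrier_hessian_mult:
  fixes x :: "real^(unit + 'd::finite + 'd)"
  assumes x: "x \<in> barrier_region"
  shows "(barrier_hessian x *v h) $ ix_u () = (\<Sum>i\<in>UNIV.
      (h $ ix_u () / x $ ix_u () - h $ ix_v i / x $ ix_v i) / slack i x
      - ln (x $ ix_u () / x $ ix_v i) * slack_deriv i x h / (slack i x)\<^sup>2
      + h $ ix_u () / (x $ ix_u ())\<^sup>2)" (is ?u)
    and "(barrier_hessian x *v h) $ ix_v i =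
      (x $ ix_u () * h $ ix_v i / x $ ix_v i - h $ ix_u ()) / (x $ ix_v i * slack i x)
      + x $ ix_u () * slack_deriv i x h / (x $ ix_v i * (slack i x)\<^sup>2)
      + h $ ix_v i / (x $ ix_v i)\<^sup>2" (is ?v)
    and "(barrier_hessian x *v h) $ ix_w i = slack_deriv i x h / (slack i x)\<^sup>2" (is ?w)
proof -
  have nz: "x $ ix_u () \<noteq> 0" "x $ ix_v i \<noteq> 0" "slack i x \<noteq> 0" for i
    using x by (auto simp: barrier_region_def less_imp_neq[THEN not_sym])
  have "(h $ ix_u () / x $ ix_u () - h $ ix_v i / x $ ix_v i) / slack i x
      - ln (x $ ix_u () / x $ ix_v i) * slack_deriv i x h / (slack i x)\<^sup>2
      + h $ ix_u () / (x $ ix_u ())\<^sup>2 =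
      (1 / (x $ ix_u () * slack i x) + (ln (x $ ix_u () / x $ ix_v i))\<^sup>2 / (slack i x)\<^sup>2
        + 1 / (x $ ix_u ())\<^sup>2) * h $ ix_u ()
      + (- 1 / (x $ ix_v i * slack i x)
        - x $ ix_u () * ln (x $ ix_u () / x $ ix_v i) / (x $ ix_v i * (slack i x)\<^sup>2)) * h $ ix_v i
      + - ln (x $ ix_u () / x $ ix_v i) / (slack i x)\<^sup>2 * h $ ix_w i" for i
    by (simp add: slack_deriv_def add_divide_distrib diff_divide_distrib algebra_simps power2_eq_square)
  then show ?u
    by (simp add: matrix_vector_mult_def sum_stacked barrier_hessian_def block_matrix_def Let_def
        sum.distrib[symmetric] sum_distrib_right)
  show ?v
    using nz(1) nz(2,3)[of i]
    by (simp add: matrix_vector_mult_def sum_stacked barrier_hessian_def block_matrix_def Let_def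
        UNIV_unit sum_Diag slack_deriv_def) (simp add: field_simps power2_eq_square)
  show ?w
    using nz(1) nz(2,3)[of i]
    by (simp add: matrix_vector_mult_def sum_stacked barrier_hessian_def block_matrix_def Let_def
        UNIV_unit sum_Diag slack_deriv_def) (simp add: field_simps power2_eq_square)
qed

lemma barrier_gradient_has_derivative:
  fixes x :: "real^(unit + 'd::finite + 'd)"
  assumes x: "x \<in> barrier_region"
  shows "(barrier_gradient has_derivative (\<lambda>h. barrier_hessian x *v h)) (at x)"
proof -
  have nz: "x $ ix_u () \<noteq> 0" "x $ ix_v i \<noteq> 0" "slack i x \<noteq> 0"
    and pos: "x $ ix_u () > 0" "x $ ix_v i > 0" for i
    using x by (auto simp: barrier_region_def less_imp_neq[THEN not_sym])
  note slack' = slack_has_derivative[OF pos]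
  have u_term: "((\<lambda>y. ln (y $ ix_u () / y $ ix_v i) / slack i y) has_derivative
      (\<lambda>h. (h $ ix_u () / x $ ix_u () - h $ ix_v i / x $ ix_v i) / slack i x
        - ln (x $ ix_u () / x $ ix_v i) * slack_deriv i x h / (slack i x)\<^sup>2)) (at x)" for i
    by (rule has_derivative_eq_rhs
        [OF has_derivative_divide'[OF log_ratio_has_derivative[OF pos] slack' nz(3)]])
      (simp add: fun_eq_iff nz diff_divide_distrib power2_eq_square mult.commute)
  have u_row: "((\<lambda>y. (\<Sum>i\<in>UNIV. ln (y $ ix_u () / y $ ix_v i) / slack i y)
        - real CARD('d) / y $ ix_u ()) has_derivative
      (\<lambda>h. (barrier_hessian x *v h) $ ix_u ())) (at x)"
    unfolding barrier_hessian_mult(1)[OF x] sum.distrib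
    by (rule has_derivative_eq_rhs[OF has_derivative_diff[OF has_derivative_sum[OF u_term]
          has_derivative_divide'[OF has_derivative_const has_derivative_component nz(1)]]])
      (simp add: fun_eq_iff power2_eq_square)
  have v_row: "((\<lambda>y. - y $ ix_u () / (y $ ix_v i * slack i y) - 1 / y $ ix_v i) has_derivative
      (\<lambda>h. (barrier_hessian x *v h) $ ix_v i)) (at x)" for i
    unfolding barrier_hessian_mult(2)[OF x]
    using nz(1) nz(2,3)[of i] by (auto intro!: derivative_eq_intros slack' simp: fun_eq_iff)
      (simp add: field_simps power2_eq_square)
  have w_row: "((\<lambda>y. - 1 / slack i y) has_derivative (\<lambda>h. (barrier_hessian x *v h) $ ix_w i)) (at x)" for i
    unfolding barrier_hessian_mult(3)[OF x]
    using nz(1) nz(2,3)[of i] by (auto intro!: derivative_eq_intros slack' simp: fun_eq_iff power2_eq_square)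
  have "((\<lambda>y. barrier_gradient y $ k) has_derivative (\<lambda>h. (barrier_hessian x *v h) $ k)) (at x)" for k
  proof (cases k)
    case (Inl a)
    then show ?thesis
      using u_row by (simp add: barrier_gradient_def stack_def)
  next
    case (Inr b)
    then show ?thesis
      using v_row w_row by (cases b) (simp_all add: barrier_gradient_def stack_def)
  qed
  then show ?thesis
    by (subst has_derivative_componentwise_within) (auto simp: Basis_vec_def inner_axis)
qed

section \<open>Positive definiteness\<close>

text \<open>The first square comes from \<open>\<nabla>\<gamma>\<^sub>i \<nabla>\<gamma>\<^sub>i\<^sup>T / \<gamma>\<^sub>i\<^sup>2\<close>. The second one comes from \<open>- \<nabla>\<^sup>2\<gamma>\<^sub>i / \<gamma>\<^sub>i\<close>:
  the function \<open>u ln (u / v\<^sub>i)\<close> is positively homogeneous of degree one in \<open>(u, v\<^sub>i)\<close>, so its second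
  differential has rank one and equals \<open>(h\<^sub>u - u / v\<^sub>i h\<^sub>v\<^sub>i)\<^sup>2 / u\<close>.\<close>

lemma hessian_quadratic_form:
  fixes x :: "real^(unit + 'd::finite + 'd)"
  assumes x: "x \<in> barrier_region"
  shows "h \<bullet> (barrier_hessian x *v h) = (\<Sum>i\<in>UNIV. (slack_deriv i x h / slack i x)\<^sup>2
      + (h $ ix_u () - x $ ix_u () / x $ ix_v i * h $ ix_v i)\<^sup>2 / (x $ ix_u () * slack i x)
      + (h $ ix_u () / x $ ix_u ())\<^sup>2 + (h $ ix_v i / x $ ix_v i)\<^sup>2)"
proof -
  define s where "s i = slack_deriv i x h" for i
  have nz: "x $ ix_u () \<noteq> 0" "x $ ix_v i \<noteq> 0" "slack i x \<noteq> 0" for i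
    using x by (auto simp: barrier_region_def less_imp_neq[THEN not_sym])
  \<comment> \<open>With the differential of the slack as a coordinate in place of \<open>h\<^sub>w\<^sub>i\<close>, the logarithms cancel
    and each summand is a rational identity.\<close>
  have w: "h $ ix_w i = s i - x $ ix_u () / x $ ix_v i * h $ ix_v i
      + ln (x $ ix_u () / x $ ix_v i) * h $ ix_u ()" for i
    by (simp add: s_def slack_deriv_def)
  have summand: "h $ ix_u () * ((h $ ix_u () / x $ ix_u () - h $ ix_v i / x $ ix_v i) / slack i x
        - ln (x $ ix_u () / x $ ix_v i) * s i / (slack i x)\<^sup>2
        + h $ ix_u () / (x $ ix_u ())\<^sup>2)
      + h $ ix_v i * ((x $ ix_u () * h $ ix_v i / x $ ix_v i - h $ ix_u ()) / (x $ ix_v i * slack i x)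
        + x $ ix_u () * s i / (x $ ix_v i * (slack i x)\<^sup>2)
        + h $ ix_v i / (x $ ix_v i)\<^sup>2)
      + h $ ix_w i * (s i / (slack i x)\<^sup>2)
    = (s i / slack i x)\<^sup>2
      + (h $ ix_u () - x $ ix_u () / x $ ix_v i * h $ ix_v i)\<^sup>2 / (x $ ix_u () * slack i x)
      + (h $ ix_u () / x $ ix_u ())\<^sup>2 + (h $ ix_v i / x $ ix_v i)\<^sup>2" for i
    unfolding w using nz(1) nz(2,3)[of i] by (simp add: field_simps power2_eq_square)
  have "h \<bullet> (barrier_hessian x *v h) = h $ ix_u () * (barrier_hessian x *v h) $ ix_u ()
      + (\<Sum>i\<in>UNIV. h $ ix_v i * (barrier_hessian x *v h) $ ix_v i)
      + (\<Sum>i\<in>UNIV. h $ ix_w i * (barrier_hessian x *v h) $ ix_w i)"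
    by (simp add: inner_vec_def sum_stacked)
  then show ?thesis
    unfolding barrier_hessian_mult[OF x] sum_distrib_left sum.distrib[symmetric]
      summand[unfolded s_def] .
qed

lemma barrier_hessian_pos_def:
  fixes x :: "real^(unit + 'd::finite + 'd)"
  assumes x: "x \<in> barrier_region"
  shows "pos_def (barrier_hessian x)"
proof -
  have pos: "x $ ix_u () > 0" "x $ ix_v i > 0" "slack i x > 0" for i
    using x by (auto simp: barrier_region_def)
  have "barrier_hessian x $ p $ q = barrier_hessian x $ q $ p" for p q
    by (auto simp: barrier_hessian_def block_matrix_def Let_def Diag_def split: sum.splits)
  then have "transpose (barrier_hessian x) = barrier_hessian x"
    by (simp add: transpose_def vec_eq_iff)
  moreover have "h \<bullet> (barrier_hessian x *v h) > 0" if "h \<noteq> 0" for h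
  proof (rule ccontr)
    define q where "q i = (slack_deriv i x h / slack i x)\<^sup>2
      + (h $ ix_u () - x $ ix_u () / x $ ix_v i * h $ ix_v i)\<^sup>2 / (x $ ix_u () * slack i x)
      + (h $ ix_u () / x $ ix_u ())\<^sup>2 + (h $ ix_v i / x $ ix_v i)\<^sup>2" for i
    have relent: "0 \<le> (h $ ix_u () - x $ ix_u () / x $ ix_v i * h $ ix_v i)\<^sup>2
        / (x $ ix_u () * slack i x)" for i
      using pos(1) pos(2,3)[of i] by simp
    have nonneg: "q i \<ge> 0" for i
      using relent[of i] by (simp add: q_def)
    assume "\<not> h \<bullet> (barrier_hessian x *v h) > 0"
    then have "(\<Sum>i\<in>UNIV. q i) \<le> 0"
      unfolding hessian_quadratic_form[OF x] q_def by linarith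
    then have "(\<Sum>i\<in>UNIV. q i) = 0"
      using nonneg by (intro antisym sum_nonneg) auto
    then have q0: "q i = 0" for i
      using nonneg by (simp add: sum_nonneg_eq_0_iff)
    have squares: "(slack_deriv i x h / slack i x)\<^sup>2 = 0" "(h $ ix_u () / x $ ix_u ())\<^sup>2 = 0"
        "(h $ ix_v i / x $ ix_v i)\<^sup>2 = 0" for i
      using q0[of i] relent[of i] zero_le_power2[of "slack_deriv i x h / slack i x"]
        zero_le_power2[of "h $ ix_u () / x $ ix_u ()"] zero_le_power2[of "h $ ix_v i / x $ ix_v i"]
      unfolding q_def by linarith+
    have u: "h $ ix_u () = 0" and v: "h $ ix_v i = 0" for i
      using squares(2) squares(3)[of i] pos(1) pos(2)[of i] by auto
    have "h $ ix_w i = 0" for i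
      using squares(1)[of i] pos(3)[of i] u v[of i] by (simp add: slack_deriv_def)
    with u v have "h = 0"
      by (simp add: vec_eq_iff split_sum_all)
    with that show False
      by simp
  qed
  ultimately show ?thesis
    by (simp add: pos_def_def)
qed

theorem theorem4:
  fixes u :: real and v w :: "real^'d"
  assumes "(u, v, w) \<in> interior Krel_dual"
  shows "let f = fstar \<circ> unstack;
             z = stack (u, v, w);
             H = hessian f z;
             \<gamma> = gam u v w;
             Dvv = Diag (\<chi> i. u * (\<gamma> i + u) / ((\<gamma> i)^2 * (v$i)^2) + 1 / (v$i)^2);
             Dww = Diag (\<chi> i. 1 / (\<gamma> i)^2);
             Dvw = Diag (\<chi> i. u / ((\<gamma> i)^2 * v$i));
             Dwv = Dvw
         in (\<forall>i. \<gamma> i > 0) \<and>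
            twice_differentiable_at f z \<and>
            augmented_sparse block_sparse 0 0 H \<and>
            pos_def H \<and>
            block_sparse H \<and>
            H = block_matrix
              (hessian_block ix_u ix_u f z) (hessian_block ix_u ix_v f z) (hessian_block ix_u ix_w f z)
              (hessian_block ix_v ix_u f z) Dvv                           Dvw
              (hessian_block ix_w ix_u f z) Dwv                           Dww"
proof -
  define z where "z = stack (u, v, w)"
  let ?f = "fstar \<circ> unstack :: real^(unit + 'd + 'd) \<Rightarrow> real"
  have z: "z $ ix_u () = u" "z $ ix_v i = v $ i" "z $ ix_w i = w $ i" "slack i z = gam u v w i" for i
    by (simp_all add: z_def stack_def slack_def gam_def)
  note pos = interior_Krel_dual_positive[OF assms]
  have region: "z \<in> barrier_region"
    by (simp add: barrier_region_def z pos)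
  have grad: "\<forall>\<^sub>F y in nhds z. (?f has_derivative (\<lambda>h. barrier_gradient y \<bullet> h)) (at y)"
    using eventually_in_barrier_region[OF region] by eventually_elim (rule fstar_has_derivative)
  note hess = hessian_from_gradient[OF grad barrier_gradient_has_derivative[OF region]]
  have H: "hessian ?f z = barrier_hessian z"
    by (simp add: hessian_def hess(2) vec_eq_iff)
  have pd: "pos_def (barrier_hessian z)"
    by (rule barrier_hessian_pos_def[OF region])
  have sparse: "block_sparse (barrier_hessian z)"
    by (simp add: block_sparse_def barrier_hessian_def block_matrix_def Let_def Diag_def)
  have aug: "augmented_sparse block_sparse 0 0 (barrier_hessian z)"
    using pd sparse by (auto simp: augmented_sparse_def pos_def_def)
  have blocks: "barrier_hessian z = block_matrix
      (hessian_block ix_u ix_u ?f z) (hessian_block ix_u ix_v ?f z) (hessian_block ix_u ix_w ?f z)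
      (hessian_block ix_v ix_u ?f z)
        (Diag (\<chi> i. u * (gam u v w i + u) / ((gam u v w i)\<^sup>2 * (v $ i)\<^sup>2) + 1 / (v $ i)\<^sup>2))
        (Diag (\<chi> i. u / ((gam u v w i)\<^sup>2 * v $ i)))
      (hessian_block ix_w ix_u ?f z)
        (Diag (\<chi> i. u / ((gam u v w i)\<^sup>2 * v $ i))) (Diag (\<chi> i. 1 / (gam u v w i)\<^sup>2))"
    by (simp add: hessian_block_def hess(2) vec_eq_iff split_sum_all barrier_hessian_def
        block_matrix_def Let_def z)
  show ?thesis
    unfolding Let_def z_def[symmetric] H
    using pos(3) hess(1) aug pd sparse blocks by blast
qed

end
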